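(* For every integer $d\ge1$, every integer $n\ge d$, and every $a=(a_1,\dots,a_{n-1})\in[0,1]^{n-1}$, $$R_d\le U_{d,n}(a).$$
   Context: Model. An admissible strategy is a sequence $a=(a_i)_{i\ge 0}$ with $a_i\in[0,1]$ and $a_0=\tfrac12$; $\mathcal A$ is the set of admissible strategies. Extend $a$ to a signed sequence $(b_i)_{i\in\mathbb Z}$ by $b_i=a_i$ for $i\ge0$ and $b_i=1-a_{-i}$ for $i<0$. Two independent Markov chains $(X_t)_{t\ge0},(Y_t)_{t\ge 0}$ on $\mathbb Z$ start at $X_0=Y_0=0$; each moves from $k$ to $k+1$ with probability $b_k$ and to $k-1$ with probability $1-b_k$. For an integer $d\ge1$ the rendezvous time is $\mathcal T_d(a)=\inf\{t\ge0: X_t=Y_t+2d\}$, and $R_d=\inf_{a\in\mathcal A}\mathbb E[\mathcal T_d(a)]$. Truncated chain. Fix $d\ge1$, $n\ge d$ and $a=(a_1,\dots,a_{n-1})\in[0,1]^{n-1}$. Set $a_0=\frac12$, $a_i=0$ for $i\ge n$, and let $(b_i)$ be the corresponding signed sequence. The level-$n$ truncated chain has states $S_{x,y}$ with $-n\le x,y\le n$, $x-y\le 2d$, $x-y$ even; states with $x-y=2d$ are absorbing; from any other state $S_{x,y}$ the two coordinates move independently, $x\mapsto x+1$ with probability $b_x$ and $x\mapsto x-1$ with probability $1-b_x$, and $y\mapsto y+1$ with probability $b_y$ and $y\mapsto y-1$ with probability $1-b_y$. $U_{d,n}(a)\in[0,\infty]$ is the expected hitting time of the absorbing set starting from $S_{0,0}$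 ($\infty$ if not finite). *)

theory Defs
  imports "HOL-Probability.Probability"
begin

text \<open>
  Homogeneous Markov chains on a discrete state space, in canonical form: a chain is its law on the
  path space of functions \<open>nat \<Rightarrow> 'a\<close>, obtained from the transition kernel by the Ionescu-Tulcea
  construction.  Lemma \<open>emeasure_chain_law_cylinder\<close> gives the finite-dimensional distributions.
\<close>

definition chain_kernel :: "('a \<Rightarrow> 'a pmf) \<Rightarrow> 'a \<Rightarrow> nat \<Rightarrow> (nat \<Rightarrow> 'a) \<Rightarrow> 'a measure" where
  "chain_kernel K x0 t \<omega> =
     measure_pmf (case t of 0 \<Rightarrow> return_pmf x0 | Suc s \<Rightarrow> K (\<omega> s))"

definition chain_law :: "('a \<Rightarrow> 'a pmf) \<Rightarrow> 'a \<Rightarrow> (nat \<Rightarrow> 'a) measure" where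
  "chain_law K x0 =
     projective_family.lim UNIV
       (Ionescu_Tulcea.CI (chain_kernel K x0) (\<lambda>_. count_space UNIV)) (\<lambda>_. count_space UNIV)"

lemma Ionescu_Tulcea_chain_kernel:
  "Ionescu_Tulcea (chain_kernel K x0) (\<lambda>_. count_space UNIV)"
proof (rule Ionescu_Tulcea.intro)
  fix t
  show "chain_kernel K x0 t
      \<in> measurable (PiM {0..<t} (\<lambda>_. count_space UNIV)) (subprob_algebra (count_space UNIV))"
  proof (cases t)
    case 0
    then show ?thesis
      by (simp add: chain_kernel_def [abs_def] measure_pmf_in_subprob_algebra)
  next
    case (Suc s)
    have "(\<lambda>\<omega>. \<omega> s) \<in> measurable (PiM {0..<t} (\<lambda>_. count_space UNIV)) (count_space UNIV)"
      using Suc by (intro measurable_component_singleton) auto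
    moreover have "(\<lambda>y. measure_pmf (K y))
        \<in> measurable (count_space UNIV) (subprob_algebra (count_space UNIV))"
      by (auto simp: measure_pmf_in_subprob_algebra)
    ultimately have "(\<lambda>\<omega>. measure_pmf (K (\<omega> s)))
        \<in> measurable (PiM {0..<t} (\<lambda>_. count_space UNIV)) (subprob_algebra (count_space UNIV))"
      by (rule measurable_compose)
    then show ?thesis
      using Suc by (simp add: chain_kernel_def [abs_def])
  qed
next
  fix t and \<omega>
  show "prob_space (chain_kernel K x0 t \<omega>)"
    unfolding chain_kernel_def by (rule measure_pmf.prob_space_axioms)
qed

lemma sets_chain_law [measurable_cong]:
  "sets (chain_law K x0) = sets (PiM UNIV (\<lambda>_. count_space UNIV))"
proof -
  interpret Ionescu_Tulcea "chain_kernel K x0" "\<lambda>_. count_space UNIV"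
    by (rule Ionescu_Tulcea_chain_kernel)
  show ?thesis by (simp add: chain_law_def)
qed

lemma emeasure_chain_law_cylinder:
  "emeasure (chain_law K x0) {\<omega>. \<forall>t\<le>n. \<omega> t = p t} =
     (if p 0 = x0 then 1 else 0) * (\<Prod>t<n. ennreal (pmf (K (p t)) (p (Suc t))))"
proof -
  interpret Ionescu_Tulcea "chain_kernel K x0" "\<lambda>_. count_space UNIV"
    by (rule Ionescu_Tulcea_chain_kernel)
  define A where "A n = PiE {0..<n} (\<lambda>t. {p t})" for n :: nat
  have A_sets [measurable]: "A n \<in> sets (PiM {0..<n} (\<lambda>_. count_space UNIV))" for n
    unfolding A_def by (rule sets_PiM_I_finite) auto
  have step: "C 0 (Suc n) (\<lambda>_. undefined) (A (Suc n)) =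
      emeasure (measure_pmf (case n of 0 \<Rightarrow> return_pmf x0 | Suc s \<Rightarrow> K (p s))) {p n}
      * C 0 n (\<lambda>_. undefined) (A n)" for n
  proof -
    let ?c = "emeasure (measure_pmf (case n of 0 \<Rightarrow> return_pmf x0 | Suc s \<Rightarrow> K (p s))) {p n}"
    have sp: "space (C 0 n (\<lambda>_. undefined)) = space (PiM {0..<n} (\<lambda>_. count_space UNIV))"
      using space_C[of "\<lambda>_. undefined" 0 n] by (simp add: space_PiM)
    have st: "sets (C 0 n (\<lambda>_. undefined)) = sets (PiM {0..<n} (\<lambda>_. count_space UNIV))"
      using sets_C[of "\<lambda>_. undefined" 0 n] by (simp add: space_PiM)
    have "C 0 (Suc n) (\<lambda>_. undefined) (A (Suc n)) =
        (\<integral>\<^sup>+ \<omega>. eP n \<omega> (A (Suc n)) \<partial>C 0 n (\<lambda>_. undefined))"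
      using sp st measurable_eP[of n]
      by (simp add: emeasure_bind[where N="PiM {0..<Suc n} (\<lambda>_. count_space UNIV)"]
          space_PiM_empty_iff measurable_cong_sets[OF st refl])
    also have "\<dots> = (\<integral>\<^sup>+ \<omega>. ?c * indicator (A n) \<omega> \<partial>C 0 n (\<lambda>_. undefined))"
    proof (rule nn_integral_cong)
      fix \<omega> assume "\<omega> \<in> space (C 0 n (\<lambda>_. undefined))"
      then have \<omega>: "\<omega> \<in> space (PiM {0..<n} (\<lambda>_. count_space UNIV))"
        by (simp add: sp)
      then have ext: "\<omega> \<in> extensional {0..<n}"
        by (simp add: space_PiM PiE_def)
      have "fun_upd \<omega> n -` A (Suc n) = (if \<omega> \<in> A n then {p n} else {})"
        using ext by (force simp: A_def PiE_iff extensional_def less_Suc_eq)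
      moreover have "chain_kernel K x0 n \<omega> =
          measure_pmf (case n of 0 \<Rightarrow> return_pmf x0 | Suc s \<Rightarrow> K (p s))" if "\<omega> \<in> A n"
        using that by (auto simp: chain_kernel_def A_def PiE_iff split: nat.split)
      ultimately show "eP n \<omega> (A (Suc n)) = ?c * indicator (A n) \<omega>"
        using \<omega> by (simp add: emeasure_eP)
    qed
    also have "\<dots> = ?c * C 0 n (\<lambda>_. undefined) (A n)"
      by (rule nn_integral_cmult_indicator) (simp add: st)
    finally show ?thesis .
  qed
  have C0: "C 0 0 (\<lambda>_. undefined) (A 0) = 1"
    using A_sets[of 0] by (simp add: A_def)
  have main: "C 0 (Suc n) (\<lambda>_. undefined) (A (Suc n)) =
      (if p 0 = x0 then 1 else 0) * (\<Prod>t<n. ennreal (pmf (K (p t)) (p (Suc t))))" for n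
  proof (induction n)
    case 0
    show ?case using step[of 0] C0 by (simp add: emeasure_pmf_single indicator_def)
  next
    case (Suc n)
    show ?case using step[of "Suc n"] unfolding Suc.IH
      by (simp add: emeasure_pmf_single mult_ac del: C.simps)
  qed
  have "{\<omega>. \<forall>t\<le>n. \<omega> t = p t} = PF.emb UNIV {0..<Suc n} (A (Suc n))"
    by (auto simp: prod_emb_def A_def PiE_iff space_PiM less_Suc_eq_le)
  then have "emeasure (chain_law K x0) {\<omega>. \<forall>t\<le>n. \<omega> t = p t} = emeasure (CI {0..<Suc n}) (A (Suc n))"
    unfolding chain_law_def by (simp add: lim)
  also have "\<dots> = C 0 (Suc n) (\<lambda>_. undefined) (A (Suc n))"
    by (subst emeasure_CI[of _ "Suc n"]) (auto simp: prod_emb_id A_def PiE_mono space_PiM simp del: C.simps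
        dest: PiE_mono)
  finally show ?thesis using main by simp
qed

lemma prob_space_chain_law: "prob_space (chain_law K x0)"
proof -
  interpret Ionescu_Tulcea "chain_kernel K x0" "\<lambda>_. count_space UNIV"
    by (rule Ionescu_Tulcea_chain_kernel)
  have "emeasure PF.lim (PF.emb UNIV {} (space (PiM {} (\<lambda>_. count_space UNIV)))) = 1"
    using prob_space.emeasure_space_1[OF PF.prob_space_P[of "{}"]]
    by (subst lim) (auto simp: PF.space_P)
  moreover have "PF.emb UNIV {} (space (PiM {} (\<lambda>_. count_space UNIV))) = UNIV"
    by (auto simp: prod_emb_def space_PiM)
  ultimately show ?thesis
    by (intro prob_spaceI) (simp add: chain_law_def space_PiM)
qed

definition first_time :: "(nat \<Rightarrow> bool) \<Rightarrow> enat" where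
  "first_time P = (INF t\<in>{t. P t}. enat t)"

definition admissible :: "(nat \<Rightarrow> real) set" where
  "admissible = {a. (\<forall>i. a i \<in> {0..1}) \<and> a 0 = 1/2}"

definition signed_seq :: "(nat \<Rightarrow> real) \<Rightarrow> int \<Rightarrow> real" where
  "signed_seq a k = (if k \<ge> 0 then a (nat k) else 1 - a (nat (- k)))"

definition walk_step :: "(nat \<Rightarrow> real) \<Rightarrow> int \<Rightarrow> int pmf" where
  "walk_step a k =
     map_pmf (\<lambda>up. if up then k + 1 else k - 1) (bernoulli_pmf (signed_seq a k))"

definition rendezvous_time :: "nat \<Rightarrow> (nat \<Rightarrow> int) \<Rightarrow> (nat \<Rightarrow> int) \<Rightarrow> enat" where
  "rendezvous_time d X Y = first_time (\<lambda>t. X t = Y t + 2 * int d)"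

text \<open>Independence of the two walkers is expressed by the product measure.\<close>

definition expected_rendezvous_time :: "nat \<Rightarrow> (nat \<Rightarrow> real) \<Rightarrow> ennreal" where
  "expected_rendezvous_time d a =
     (\<integral>\<^sup>+ (X, Y). ennreal_of_enat (rendezvous_time d X Y)
        \<partial>(chain_law (walk_step a) 0 \<Otimes>\<^sub>M chain_law (walk_step a) 0))"

definition R :: "nat \<Rightarrow> ennreal" where
  "R d = (INF a\<in>admissible. expected_rendezvous_time d a)"

text \<open>
  The truncated chain.  A tuple \<open>(a\<^sub>1, \<dots>, a\<^sub>n\<^sub>-\<^sub>1)\<close> is a function on \<open>nat\<close> of which only the values at
  \<open>1, \<dots>, n - 1\<close> are used.
\<close>

definition truncated_strategy :: "nat \<Rightarrow> (nat \<Rightarrow> real) \<Rightarrow> nat \<Rightarrow> real" where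
  "truncated_strategy n a i = (if i = 0 then 1/2 else if i < n then a i else 0)"

definition trunc_states :: "nat \<Rightarrow> nat \<Rightarrow> (int \<times> int) set" where
  "trunc_states d n =
     {(x, y). x \<in> {- int n..int n} \<and> y \<in> {- int n..int n} \<and> x - y \<le> 2 * int d \<and> even (x - y)}"

definition trunc_absorbing :: "nat \<Rightarrow> nat \<Rightarrow> (int \<times> int) set" where
  "trunc_absorbing d n = {(x, y) \<in> trunc_states d n. x - y = 2 * int d}"

text \<open>
  The values of the kernel outside \<open>trunc_states d n\<close> are irrelevant: by \<open>trunc_step_closed\<close> the
  chain never leaves this set.
\<close>

definition trunc_step :: "nat \<Rightarrow> nat \<Rightarrow> (nat \<Rightarrow> real) \<Rightarrow> int \<times> int \<Rightarrow> (int \<times> int) pmf" where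
  "trunc_step d n a = (\<lambda>(x, y).
     if (x, y) \<in> trunc_absorbing d n then return_pmf (x, y)
     else pair_pmf (walk_step (truncated_strategy n a) x) (walk_step (truncated_strategy n a) y))"

definition U :: "nat \<Rightarrow> nat \<Rightarrow> (nat \<Rightarrow> real) \<Rightarrow> ennreal" where
  "U d n a =
     (\<integral>\<^sup>+ \<omega>. ennreal_of_enat (first_time (\<lambda>t. \<omega> t \<in> trunc_absorbing d n))
        \<partial>chain_law (trunc_step d n a) (0, 0))"

lemma walk_step_truncated_range:
  assumes "1 \<le> n" and x: "x \<in> {- int n..int n}"
    and "x' \<in> set_pmf (walk_step (truncated_strategy n a) x)"
  shows "x' \<in> {- int n..int n} \<and> (x' = x + 1 \<or> x' = x - 1)"
proof -
  let ?b = "signed_seq (truncated_strategy n a) x"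
  obtain up where up: "up \<in> set_pmf (bernoulli_pmf ?b)" "x' = (if up then x + 1 else x - 1)"
    using assms(3) by (auto simp: walk_step_def)
  have hi: "\<not> up" if "x = int n"
  proof -
    have "?b = 0" using that assms(1) by (simp add: signed_seq_def truncated_strategy_def)
    then show ?thesis using up(1) by (auto simp: set_pmf_iff)
  qed
  have lo: up if "x = - int n"
  proof (rule ccontr)
    assume "\<not> up"
    have "?b = 1" using that assms(1) by (simp add: signed_seq_def truncated_strategy_def)
    then show False using up(1) \<open>\<not> up\<close> by (auto simp: set_pmf_iff)
  qed
  show ?thesis
  proof (cases up)
    case True
    then have "x \<noteq> int n" using hi by blast
    then show ?thesis using True up(2) x by auto
  next
    case False
    then have "x \<noteq> - int n" using lo by blast
    then show ?thesis using False up(2) x by auto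
  qed
qed

lemma trunc_step_closed:
  assumes "1 \<le> d" and "d \<le> n" and "s \<in> trunc_states d n"
  shows "set_pmf (trunc_step d n a s) \<subseteq> trunc_states d n"
proof (cases "s \<in> trunc_absorbing d n")
  case True
  then show ?thesis using assms(3) by (cases s) (auto simp: trunc_step_def)
next
  case False
  obtain x y where s: "s = (x, y)" by (cases s)
  have xy: "x \<in> {- int n..int n}" "y \<in> {- int n..int n}" "even (x - y)" "x - y < 2 * int d"
    using assms(3) False by (auto simp: s trunc_states_def trunc_absorbing_def)
  then have gap: "x - y \<le> 2 * int d - 2" by presburger
  show ?thesis
  proof
    fix s' assume "s' \<in> set_pmf (trunc_step d n a s)"
    then obtain x' y' where s': "s' = (x', y')"
      and x': "x' \<in> set_pmf (walk_step (truncated_strategy n a) x)"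
      and y': "y' \<in> set_pmf (walk_step (truncated_strategy n a) y)"
      using False by (auto simp: s trunc_step_def)
    have "1 \<le> n" using assms by simp
    note X = walk_step_truncated_range[OF this xy(1) x']
     and Y = walk_step_truncated_range[OF this xy(2) y']
    then have "x' - y' \<le> 2 * int d" "even (x' - y')"
      using gap xy(3) by auto
    then show "s' \<in> trunc_states d n"
      using X Y by (simp add: s' trunc_states_def)
  qed
qed

end

theory Submission
  imports Defs
begin

text \<open>
  The truncated strategy is itself admissible.  A pair of paths that avoids \<open>x - y = 2 * d\<close> up to time
  \<open>t\<close> has the same probability under two independent walkers and under the truncated chain, because
  the two mechanisms differ only at absorbing states.  Summing over such paths bounds the tail of the
  rendezvous time by the tail of the absorption time, and summing the tails bounds the expectations.
\<close>

text \<open>An infimum in \<open>enat\<close> over the empty set is \<open>\<infinity>\<close>,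
  otherwise it is attained at the least time. The \<open>LEAST\<close> form, unlike the infimum, is
  accessible to the automation in \<open>measurable_first_time\<close>.\<close>

lemma first_time_altdef:
  "first_time P = (if \<exists>t. P t then enat (LEAST t. P t) else \<infinity>)"
proof (cases "\<exists>t. P t")
  case True
  then have "P (LEAST t. P t)" by (metis LeastI)
  then show ?thesis
    using True unfolding first_time_def
    by (auto intro!: antisym INF_greatest Least_le INF_lower2)
qed (simp add: first_time_def top_enat_def)

text \<open>The bound \<open>s \<le> t\<close> is inclusive because the strict inequality excludes a
  hit at time \<open>t\<close> itself. This matches the cylinders over times
  \<open>0, ..., t\<close> whose probabilities are known.\<close>

lemma less_first_time_iff: "enat t < first_time P \<longleftrightarrow> (\<forall>s\<le>t. \<not> P s)"
proof (cases "\<exists>s. P s")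
  case True
  then have "P (LEAST s. P s)" by (metis LeastI)
  moreover have "\<not> P s" if "s < (LEAST s. P s)" for s
    using that by (rule not_less_Least)
  ultimately have "t < (LEAST s. P s) \<longleftrightarrow> (\<forall>s\<le>t. \<not> P s)"
    by (meson le_less_trans not_le)
  then show ?thesis using True by (simp add: first_time_altdef)
qed (simp add: first_time_altdef)

lemma measurable_first_time:
  assumes "\<And>t. Measurable.pred M (\<lambda>x. P x t)"
  shows "(\<lambda>x. first_time (P x)) \<in> measurable M (count_space UNIV)"
  using assms unfolding first_time_altdef by measurable

lemma sets_Collect_all_le_not:
  fixes P :: "'a \<Rightarrow> nat \<Rightarrow> bool"
  assumes [measurable]: "\<And>t. Measurable.pred M (\<lambda>x. P x t)"
  shows "{x \<in> space M. \<forall>s\<le>t. \<not> P x s} \<in> sets M"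
  by measurable

text \<open>Tail-sum formula: the expectation of a random time \<open>T\<close> is the sum over
  \<open>t\<close> of the probabilities of \<open>T > t\<close>. It covers infinite values of
  \<open>T\<close>, so no finiteness of expectations has to be established.\<close>

lemma nn_integral_first_time:
  assumes "\<And>t. Measurable.pred M (\<lambda>x. P x t)"
  shows "(\<integral>\<^sup>+ x. ennreal_of_enat (first_time (P x)) \<partial>M)
       = (\<Sum>t. emeasure M {x \<in> space M. \<forall>s\<le>t. \<not> P x s})"
  using nn_integral_enat_function[OF measurable_first_time[OF assms]]
  by (simp add: less_first_time_iff)

lemma space_chain_law: "space (chain_law K x0) = UNIV"
  using sets_eq_imp_space_eq[OF sets_chain_law] by (simp add: space_PiM)

lemma measurable_chain_law_component [measurable]:
  "(\<lambda>\<omega>. \<omega> t) \<in> measurable (chain_law K x0) (count_space UNIV)"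
  by (simp add: measurable_cong_sets[OF sets_chain_law refl])

text \<open>A countable state space has only countably many path segments over times
  \<open>0, ..., t\<close>, so the event splits into countably many disjoint cylinders. The integral
  over \<open>count_space\<close> is the resulting sum.\<close>

lemma emeasure_countable_paths:
  fixes F :: "'a \<Rightarrow> nat \<Rightarrow> 's :: countable"
  assumes "\<And>s. (\<lambda>x. F x s) \<in> measurable M (count_space UNIV)"
  shows "emeasure M {x \<in> space M. \<forall>s\<le>t. Q (F x s)}
       = (\<integral>\<^sup>+ p. emeasure M {x \<in> space M. \<forall>s\<le>t. F x s = p s}
            \<partial>count_space ({..t} \<rightarrow>\<^sub>E {z. Q z}))"
proof -
  note assms [measurable]
  let ?E = "\<lambda>p. {x \<in> space M. \<forall>s\<le>t. F x s = p s}"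
  let ?I = "{..t} \<rightarrow>\<^sub>E {z. Q z}"
  have "{x \<in> space M. \<forall>s\<le>t. Q (F x s)} = (\<Union>p\<in>?I. ?E p)"
  proof (intro equalityI subsetI)
    fix x assume "x \<in> {x \<in> space M. \<forall>s\<le>t. Q (F x s)}"
    then show "x \<in> (\<Union>p\<in>?I. ?E p)"
      \<comment> \<open>The segment is cut off after \<open>t\<close> to be extensional, so each
        path yields exactly one index.\<close>
      by (intro UN_I[where a = "restrict (F x) {..t}"]) auto
  qed (auto simp: PiE_iff)
  moreover have "disjoint_family_on ?E ?I"
    unfolding disjoint_family_on_def
  proof (intro ballI impI)
    fix p q assume "p \<in> ?I" "q \<in> ?I" "p \<noteq> q"
    then obtain s where "s \<le> t" "p s \<noteq> q s"
      \<comment> \<open>Distinct extensional functions on \<open>{..t}\<close> already differ at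
        some time up to \<open>t\<close>.\<close>
      by (metis PiE_ext atMost_iff)
    then show "?E p \<inter> ?E q = {}" by auto
  qed
  moreover have "countable ?I"
    by (rule countable_PiE) auto
  moreover have "?E p \<in> sets M" for p
    by measurable
  ultimately show ?thesis
    by (simp only: emeasure_UN_countable)
qed

lemma pmf_trunc_step:
  assumes "fst z - snd z \<noteq> 2 * int d"
  shows "pmf (trunc_step d n a z) w
       = pmf (walk_step (truncated_strategy n a) (fst z)) (fst w)
         * pmf (walk_step (truncated_strategy n a) (snd z)) (snd w)"
  using assms by (cases z; cases w) (simp add: trunc_step_def trunc_absorbing_def pmf_pair)

text \<open>Each side is a product of one-step probabilities along \<open>p\<close>. Since
  \<open>p\<close> stays off the meeting line, every factor for the truncated chain splits into one
  factor per walker by \<open>pmf_trunc_step\<close>.\<close>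

lemma pair_cylinder_eq_trunc_cylinder:
  fixes n :: nat and a :: "nat \<Rightarrow> real"
  assumes "\<And>s. s \<le> t \<Longrightarrow> fst (p s) - snd (p s) \<noteq> 2 * int d"
  defines "W \<equiv> chain_law (walk_step (truncated_strategy n a)) 0"
  shows "emeasure (W \<Otimes>\<^sub>M W) {x \<in> space (W \<Otimes>\<^sub>M W). \<forall>s\<le>t. (fst x s, snd x s) = p s}
       = emeasure (chain_law (trunc_step d n a) (0, 0)) {\<omega>. \<forall>s\<le>t. \<omega> s = p s}"
proof -
  interpret W: prob_space W unfolding W_def by (rule prob_space_chain_law)
  note [measurable] =
    measurable_chain_law_component[of _ "walk_step (truncated_strategy n a)" 0, folded W_def]
  have space_W: "space W = UNIV" by (simp add: W_def space_chain_law)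
  \<comment> \<open>Fixing the joint segment fixes each walker's own segment, so the event is a
    rectangle and the product measure factorises.\<close>
  let ?X = "{\<omega>. \<forall>s\<le>t. \<omega> s = fst (p s)}" and ?Y = "{\<omega>. \<forall>s\<le>t. \<omega> s = snd (p s)}"
  have "{\<omega> \<in> space W. \<forall>s\<le>t. \<omega> s = c s} \<in> sets W" for c by measurable
  then have "?X \<in> sets W" "?Y \<in> sets W" by (simp_all add: space_W)
  then have "emeasure (W \<Otimes>\<^sub>M W) (?X \<times> ?Y) = emeasure W ?X * emeasure W ?Y"
    by (rule W.emeasure_pair_measure_Times)
  moreover have "{x \<in> space (W \<Otimes>\<^sub>M W). \<forall>s\<le>t. (fst x s, snd x s) = p s} = ?X \<times> ?Y"
    by (auto simp: space_pair_measure space_W prod_eq_iff)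
  moreover have "emeasure W ?X * emeasure W ?Y
      = emeasure (chain_law (trunc_step d n a) (0, 0)) {\<omega>. \<forall>s\<le>t. \<omega> s = p s}"
    using assms(1)
    unfolding W_def emeasure_chain_law_cylinder
    by (simp add: pmf_trunc_step prod.distrib ennreal_mult prod_eq_iff)
  ultimately show ?thesis by simp
qed

lemma truncated_strategy_admissible:
  assumes "\<forall>i\<in>{1..<n}. a i \<in> {0..1}"
  shows "truncated_strategy n a \<in> admissible"
  using assms by (auto simp: admissible_def truncated_strategy_def)

lemma expected_rendezvous_time_truncated_le_U:
  "expected_rendezvous_time d (truncated_strategy n a) \<le> U d n a"
proof -
  define W where "W = chain_law (walk_step (truncated_strategy n a)) 0"
  define V where "V = chain_law (trunc_step d n a) (0, 0)"
  note [measurable] =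
    measurable_chain_law_component[of _ "walk_step (truncated_strategy n a)" 0, folded W_def]
    measurable_chain_law_component[of _ "trunc_step d n a" "(0, 0)", folded V_def]
  have meas_pair: "(\<lambda>x. (fst x s, snd x s)) \<in> measurable (W \<Otimes>\<^sub>M W) (count_space UNIV)" for s
  proof -
    have "(\<lambda>x. (fst x s, snd x s))
        \<in> measurable (W \<Otimes>\<^sub>M W) (count_space UNIV \<Otimes>\<^sub>M count_space UNIV)"
      by (intro measurable_Pair measurable_compose[OF measurable_fst]
          measurable_compose[OF measurable_snd]) measurable
    \<comment> \<open>The product of two countable discrete spaces is again discrete.\<close>
    then show ?thesis by (simp add: pair_measure_countable)
  qed
  have meas_abs: "Measurable.pred V (\<lambda>\<omega>. \<omega> s \<in> trunc_absorbing d n)" for s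
    unfolding V_def by (rule measurable_compose[OF measurable_chain_law_component]) simp
  let ?meet = "\<lambda>z :: int \<times> int. fst z - snd z = 2 * int d"
  let ?Z = "\<lambda>x s. (fst x s, snd x s) :: int \<times> int"
  have tail: "emeasure (W \<Otimes>\<^sub>M W) {x \<in> space (W \<Otimes>\<^sub>M W). \<forall>s\<le>t. \<not> ?meet (?Z x s)}
      \<le> emeasure V {\<omega> \<in> space V. \<forall>s\<le>t. \<omega> s \<notin> trunc_absorbing d n}" for t
  proof -
    have "emeasure (W \<Otimes>\<^sub>M W) {x \<in> space (W \<Otimes>\<^sub>M W). \<forall>s\<le>t. \<not> ?meet (?Z x s)}
        = (\<integral>\<^sup>+ p. emeasure (W \<Otimes>\<^sub>M W) {x \<in> space (W \<Otimes>\<^sub>M W). \<forall>s\<le>t. ?Z x s = p s}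
             \<partial>count_space ({..t} \<rightarrow>\<^sub>E {z. \<not> ?meet z}))"
      by (rule emeasure_countable_paths[where F = ?Z and Q = "\<lambda>z. \<not> ?meet z"]) (rule meas_pair)
    also have "\<dots> = (\<integral>\<^sup>+ p. emeasure V {\<omega> \<in> space V. \<forall>s\<le>t. \<omega> s = p s}
             \<partial>count_space ({..t} \<rightarrow>\<^sub>E {z. \<not> ?meet z}))"
    proof (rule nn_integral_cong)
      fix p assume "p \<in> space (count_space ({..t} \<rightarrow>\<^sub>E {z. \<not> ?meet z}))"
      then have "\<not> ?meet (p s)" if "s \<le> t" for s using that by (auto simp: PiE_iff)
      then show "emeasure (W \<Otimes>\<^sub>M W) {x \<in> space (W \<Otimes>\<^sub>M W). \<forall>s\<le>t. ?Z x s = p s}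
          = emeasure V {\<omega> \<in> space V. \<forall>s\<le>t. \<omega> s = p s}"
        unfolding W_def V_def by (simp add: pair_cylinder_eq_trunc_cylinder space_chain_law)
    qed
    \<comment> \<open>The same path decomposition, read backwards for the truncated chain.\<close>
    also have "\<dots> = emeasure V {\<omega> \<in> space V. \<forall>s\<le>t. \<not> ?meet (\<omega> s)}"
      by (rule emeasure_countable_paths[where F = "\<lambda>\<omega>. \<omega>" and Q = "\<lambda>z. \<not> ?meet z", symmetric])
        measurable
    \<comment> \<open>Absorbing states lie on the meeting line, so avoiding the line avoids them.
      This inclusion is the only source of inequality between the tails.\<close>
    also have "\<dots> \<le> emeasure V {\<omega> \<in> space V. \<forall>s\<le>t. \<omega> s \<notin> trunc_absorbing d n}"
    proof (rule emeasure_mono)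
      show "{\<omega> \<in> space V. \<forall>s\<le>t. \<omega> s \<notin> trunc_absorbing d n} \<in> sets V"
        using meas_abs by (rule sets_Collect_all_le_not)
    qed (auto simp: trunc_absorbing_def)
    finally show ?thesis .
  qed
  have "expected_rendezvous_time d (truncated_strategy n a)
      = (\<integral>\<^sup>+ x. ennreal_of_enat (first_time (\<lambda>s. ?meet (?Z x s))) \<partial>(W \<Otimes>\<^sub>M W))"
    unfolding expected_rendezvous_time_def W_def rendezvous_time_def
    by (intro nn_integral_cong) (auto simp: diff_eq_eq add.commute[of "2 * int d"])
  also have "\<dots> = (\<Sum>t. emeasure (W \<Otimes>\<^sub>M W) {x \<in> space (W \<Otimes>\<^sub>M W). \<forall>s\<le>t. \<not> ?meet (?Z x s)})"
    by (rule nn_integral_first_time[where P = "\<lambda>x s. ?meet (?Z x s)"])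
      (rule measurable_compose[OF meas_pair], simp)
  also have "\<dots> \<le> (\<Sum>t. emeasure V {\<omega> \<in> space V. \<forall>s\<le>t. \<omega> s \<notin> trunc_absorbing d n})"
    by (intro suminf_le tail) auto
  also have "\<dots> = U d n a"
    unfolding U_def V_def[symmetric]
    by (rule nn_integral_first_time[where P = "\<lambda>\<omega> s. \<omega> s \<in> trunc_absorbing d n", symmetric])
      (rule meas_abs)
  finally show ?thesis .
qed

theorem lemma3:
  fixes d n :: nat and a :: "nat \<Rightarrow> real"
  assumes "1 \<le> d" and "d \<le> n" and "\<forall>i\<in>{1..<n}. a i \<in> {0..1}"
  shows "R d \<le> U d n a"
  unfolding R_def
  \<comment> \<open>A single admissible competitor bounds the infimum from above.\<close>
  by (rule INF_lower2, rule truncated_strategy_admissible[OF assms(3)])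
    (rule expected_rendezvous_time_truncated_le_U)

end
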